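(* Let $(L,\leq)$ be a weakly atomic completely semidistributive (complete) lattice. For $x\in L$, the following are equivalent: (1) $x$ is left modular. (2) For each $j\in\mathrm{JI}^c(L)$, either $j\leq x$ or $x\leq\kappa(j)$ holds. (3) For any cover relation $y\lessdot z$ in $L$, we have $x\vee y=x\vee z$ or $x\wedge y=x\wedge z$, but not both. (4) $x=\bigvee_{j\in S}j$ for some successor-closed set $S$ of vertices of the labelling quiver $Q_L$ of $L$. Moreover, the set $\mathrm{LM}(L)$ of left modular elements of $L$ forms a complete sublattice of $L$, which is completely distributive.
   Context: Lattices are complete and possibly infinite; $x\lessdot y$ denotes a cover relation. $L$ is weakly atomic if for all $x<y$ there are $u,v$ with $x\leq u\lessdot v\leq y$. $L$ is completely semidistributive if for all $x\in L$, $S\subseteq L$: if $x\vee y=x\vee z$ for all $y,z\in S$ then $x\vee\bigwedge S=x\vee y$ for all $y\in S$; and dually, if $x\wedge y=x\wedge z$ for all $y,z\in S$ then $x\wedge\bigvee S=x\wedge y$ for all $y\in S$. $\mathrm{JI}^c(L)$ is the set of completely join-irreducible elements: those $x\neq\bigvee\emptyset$ with $x\neq\bigvee S$ for every $S\subseteq\{y\mid y<x\}$; then $x_*:=\bigvee\{y\mid y<x\}$ is the unique lower cover of $x$. $\mathrm{MI}^c(L)$ (completely meet-irreducible elements) is defined dually. For $L$ as in the claim there is a bijection $\kappa:\mathrm{JI}^c(L)\to\mathrm{MI}^c(L)$, $\kappa(j)=\max\{y\in L\mid j\wedge y=j_*\}$ (the maximum exists; known fact). An element $x\in L$ is left modular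 if $(y\vee x)\wedge z=y\vee(x\wedge z)$ for all $y\leq z$ in $L$. The labelling quiver $Q_L$ is the directed graph with vertex set $\mathrm{JI}^c(L)$ and, for $i,j\in\mathrm{JI}^c(L)$, an arrow $i\to j$ precisely when $i\neq j$ and $i\not\leq\kappa(j)$. A set $S$ of vertices is successor-closed if for every arrow $i\to j$ in $Q_L$, $i\in S$ implies $j\in S$. A complete sublattice is a subset closed under arbitrary joins and meets computed in $L$. *)

theory Defs
  imports Main "Graph_Theory.Pair_Digraph"
begin

text \<open>
  A complete lattice is a type of class \<^class>\<open>complete_lattice\<close>. Properties of the whole lattice
  take the type as an argument of type \<open>'a itself\<close>.
\<close>

definition covers :: "'a::order \<Rightarrow> 'a \<Rightarrow> bool" (infix "\<lessdot>" 50) where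
  "x \<lessdot> y \<longleftrightarrow> x < y \<and> \<not> (\<exists>z. x < z \<and> z < y)"

definition weakly_atomic :: "'a::complete_lattice itself \<Rightarrow> bool" where
  "weakly_atomic _ \<longleftrightarrow>
     (\<forall>x y::'a. x < y \<longrightarrow> (\<exists>u v. x \<le> u \<and> u \<lessdot> v \<and> v \<le> y))"

definition completely_semidistributive :: "'a::complete_lattice itself \<Rightarrow> bool" where
  "completely_semidistributive _ \<longleftrightarrow>
     (\<forall>(x::'a) S. (\<forall>y\<in>S. \<forall>z\<in>S. sup x y = sup x z) \<longrightarrow> (\<forall>y\<in>S. sup x (Inf S) = sup x y)) \<and>
     (\<forall>(x::'a) S. (\<forall>y\<in>S. \<forall>z\<in>S. inf x y = inf x z) \<longrightarrow> (\<forall>y\<in>S. inf x (Sup S) = inf x y))"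

definition JIc :: "'a::complete_lattice set" where
  "JIc = {x. x \<noteq> Sup {} \<and> (\<forall>S. S \<subseteq> {y. y < x} \<longrightarrow> x \<noteq> Sup S)}"

definition lower_star :: "'a::complete_lattice \<Rightarrow> 'a" where
  "lower_star x = Sup {y. y < x}"

text \<open>
  \<^term>\<open>Greatest\<close> is a definite description: \<open>kappa j\<close> is meaningful when the maximum exists, which
  is the case for every \<open>j \<in> JIc\<close> in a completely semidistributive lattice.
\<close>

definition kappa :: "'a::complete_lattice \<Rightarrow> 'a" where
  "kappa j = (GREATEST y. inf j y = lower_star j)"

definition left_modular :: "'a::complete_lattice \<Rightarrow> bool" where
  "left_modular x \<longleftrightarrow> (\<forall>y z. y \<le> z \<longrightarrow> inf (sup y x) z = sup y (inf x z))"

definition LM :: "'a::complete_lattice set" where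
  "LM = {x. left_modular x}"

definition labelling_quiver :: "'a::complete_lattice pair_pre_digraph" where
  "labelling_quiver =
     \<lparr> pverts = JIc,
       parcs = {(i, j). i \<in> JIc \<and> j \<in> JIc \<and> i \<noteq> j \<and> \<not> i \<le> kappa j} \<rparr>"

definition successor_closed :: "'v pair_pre_digraph \<Rightarrow> 'v set \<Rightarrow> bool" where
  "successor_closed Q S \<longleftrightarrow>
     S \<subseteq> pverts Q \<and> (\<forall>i j. (i, j) \<in> parcs Q \<longrightarrow> i \<in> S \<longrightarrow> j \<in> S)"

text \<open>The case \<open>A = {}\<close> forces both \<^term>\<open>bot\<close> and \<^term>\<open>top\<close> to lie in \<open>M\<close>.\<close>

definition complete_sublattice :: "'a::complete_lattice set \<Rightarrow> bool" where
  "complete_sublattice M \<longleftrightarrow> (\<forall>A. A \<subseteq> M \<longrightarrow> Sup A \<in> M \<and> Inf A \<in> M)"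

text \<open>
  The law of class \<^class>\<open>complete_distrib_lattice\<close>, relativised to the families of subsets of a
  complete sublattice \<open>M\<close>. The joins and meets of \<open>M\<close> are those of the ambient lattice precisely
  because \<open>M\<close> is a complete sublattice; for other subsets the definition is not meaningful.
\<close>

definition completely_distributive_on :: "'a::complete_lattice set \<Rightarrow> bool" where
  "completely_distributive_on M \<longleftrightarrow>
     (\<forall>\<A>. (\<forall>A\<in>\<A>. A \<subseteq> M) \<longrightarrow>
        Inf (Sup ` \<A>) = Sup (Inf ` {f ` \<A> | f. \<forall>A\<in>\<A>. f A \<in> A}))"

end

theory Submission
  imports Defs
begin

text \<open>
  Everything rests on the dichotomy \<open>j \<le> x \<or> x \<le> kappa j\<close>, which says that an element makes a
  definite choice at each completely join-irreducible \<open>j\<close>.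

  Complete semidistributivity attaches to each cover \<open>y \<lessdot> z\<close> a label \<open>j\<close>, the least element whose
  join with \<open>y\<close> is \<open>z\<close>. It is completely join-irreducible and recovers the cover from either side:
  \<open>sup y j = z\<close> and \<open>inf z (kappa j) = y\<close> (\<open>cover_label\<close>). An element above \<open>j\<close> therefore
  identifies \<open>y\<close> and \<open>z\<close> under joins but not under meets, and an element below \<open>kappa j\<close> does the
  opposite, so the dichotomy gives the condition on covers. Conversely each \<open>j\<close> covers
  \<open>lower_star j\<close>, and the condition on that single cover is the dichotomy at \<open>j\<close>.

  The condition on covers is left modularity tested locally. The modular inequality
  \<open>sup y (inf x z) \<le> inf (sup y x) z\<close> always holds, and joining or meeting with \<open>x\<close> cannot tell its
  two sides apart. If it is strict, weak atomicity places a cover between the two sides, and \<open>x\<close>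
  identifies the ends of that cover under both operations.

  Weak atomicity also makes every element the join of the elements of \<open>JIc\<close> below it
  (\<open>Sup_JIc_below\<close>). Under this description, the dichotomy says that these elements form a
  successor-closed set. Finally, the dichotomy passes to arbitrary joins and meets, and by it each
  \<open>j\<close> is completely join-prime with respect to left modular elements (\<open>dichotomy_join_prime\<close>).
  Since the \<open>j\<close> generate the lattice by joins, complete distributivity follows.
\<close>

section \<open>Completely join-irreducible elements and their partners\<close>

lemma lower_star_le: "lower_star j \<le> j"
  unfolding lower_star_def by (rule Sup_least) auto

lemma lower_star_covered:
  assumes "j \<in> (JIc :: 'a::complete_lattice set)"
  shows "lower_star j \<lessdot> j"
proof -
  have "lower_star j \<noteq> j"
    using assms unfolding JIc_def lower_star_def by (metis (mono_tags, lifting) mem_Collect_eq order_refl)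
  moreover have "w \<le> lower_star j" if "w < j" for w
    unfolding lower_star_def using that by (auto intro: Sup_upper)
  ultimately show ?thesis
    using lower_star_le[of j] unfolding covers_def by (auto simp: order.strict_iff_order dest: antisym)
qed

lemma le_lower_star: "w < j \<Longrightarrow> w \<le> lower_star j"
  unfolding lower_star_def by (auto intro: Sup_upper)

text \<open>
  The element \<open>y\<close> bounds every join of elements strictly below \<open>j\<close>, so no such join, the empty one
  included, can be \<open>j\<close>.
\<close>

lemma JIcI:
  assumes "\<not> j \<le> y" and "\<And>w. w < j \<Longrightarrow> w \<le> y"
  shows "j \<in> JIc"
proof -
  have "j \<noteq> Sup S" if "S \<subseteq> {w. w < j}" for S
    using assms that by (metis (mono_tags, lifting) Sup_least mem_Collect_eq subsetD)
  then show ?thesis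
    unfolding JIc_def by blast
qed

text \<open>
  The set of \<open>y\<close> with \<open>inf j y = lower_star j\<close> contains \<open>lower_star j\<close>, so it is nonempty and meet
  semidistributivity applies: its supremum belongs to it.
\<close>

lemma kappa_greatest:
  assumes sd: "completely_semidistributive TYPE('a::complete_lattice)"
    and j: "j \<in> (JIc :: 'a set)"
  shows "inf j (kappa j) = lower_star j"
    and "inf j y = lower_star j \<Longrightarrow> y \<le> kappa j"
proof -
  let ?S = "{y. inf j y = lower_star j}"
  have "lower_star j \<in> ?S"
    using lower_star_le[of j] by (simp add: inf.absorb2)
  moreover have "\<forall>y\<in>?S. \<forall>z\<in>?S. inf j y = inf j z"
    by simp
  ultimately have "inf j (Sup ?S) = inf j (lower_star j)"
    using sd unfolding completely_semidistributive_def by blast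
  then have max: "inf j (Sup ?S) = lower_star j"
    using \<open>lower_star j \<in> ?S\<close> by simp
  have kappa: "kappa j = Sup ?S"
    unfolding kappa_def by (rule Greatest_equality) (auto simp: max intro: Sup_upper)
  show "inf j (kappa j) = lower_star j"
    using max kappa by simp
  show "y \<le> kappa j" if "inf j y = lower_star j"
    using that kappa by (auto intro: Sup_upper)
qed

lemma not_le_kappa:
  assumes "completely_semidistributive TYPE('a::complete_lattice)"
    and "j \<in> (JIc :: 'a set)"
  shows "\<not> j \<le> kappa j"
  using kappa_greatest(1)[OF assms] lower_star_covered[OF assms(2)]
  by (metis covers_def inf.absorb1 less_irrefl)

text \<open>
  Above \<open>lower_star j\<close> the dichotomy holds for every element: there the meet with \<open>j\<close> is either
  \<open>j\<close> or \<open>lower_star j\<close>.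
\<close>

lemma le_or_le_kappa_above_lower_star:
  assumes "completely_semidistributive TYPE('a::complete_lattice)"
    and "j \<in> (JIc :: 'a set)"
    and "lower_star j \<le> y"
  shows "j \<le> y \<or> y \<le> kappa j"
proof (cases "j \<le> y")
  case False
  then have "inf j y \<le> lower_star j"
    by (intro le_lower_star) (metis inf.orderI inf_le1 order_le_imp_less_or_eq)
  moreover have "lower_star j \<le> inf j y"
    using lower_star_le assms(3) by simp
  ultimately show ?thesis
    using kappa_greatest(2)[OF assms(1,2)] by (simp add: antisym)
qed simp

section \<open>Labels of covers\<close>

text \<open>
  The label is the meet of all \<open>w\<close> with \<open>sup y w = z\<close>, which has this property itself by join
  semidistributivity. Anything strictly below it joins with \<open>y\<close> to something strictly below \<open>z\<close>,
  hence to \<open>y\<close>; so \<open>y\<close> witnesses complete join-irreducibility.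
\<close>

lemma cover_label:
  fixes y z :: "'a::complete_lattice"
  assumes sd: "completely_semidistributive TYPE('a)" and cov: "y \<lessdot> z"
  obtains j where "j \<in> JIc" "sup y j = z" "inf z (kappa j) = y"
proof -
  let ?S = "{w. sup y w = z}"
  define j where "j = Inf ?S"
  have yz: "y < z" and between: "\<And>w. y \<le> w \<Longrightarrow> w \<le> z \<Longrightarrow> w \<noteq> z \<Longrightarrow> w = y"
    using cov unfolding covers_def by (auto simp: order.order_iff_strict)
  have "z \<in> ?S"
    using yz by (simp add: sup.absorb2)
  moreover have "\<forall>v\<in>?S. \<forall>w\<in>?S. sup y v = sup y w"
    by simp
  ultimately have "sup y (Inf ?S) = sup y z"
    using sd unfolding completely_semidistributive_def by blast
  then have join: "sup y j = z"
    using yz by (simp add: j_def sup.absorb2)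
  have not_le: "\<not> j \<le> y"
    using join yz by (auto simp: sup.absorb1)
  have below: "w \<le> y" if "w < j" for w
  proof -
    have "sup y w \<noteq> z"
      using that unfolding j_def by (metis (mono_tags, lifting) Inf_lower leD mem_Collect_eq)
    moreover have "sup y w \<le> z"
      using join that by (metis less_imp_le order_refl sup.mono)
    ultimately have "sup y w = y"
      by (intro between) auto
    then show ?thesis
      by (metis sup_ge2)
  qed
  have J: "j \<in> JIc"
    using not_le below by (rule JIcI)
  have "lower_star j \<le> y"
    using lower_star_covered[OF J] by (intro below) (simp add: covers_def)
  with not_le have "y \<le> kappa j"
    using le_or_le_kappa_above_lower_star[OF sd J] by blast
  moreover have "inf z (kappa j) \<noteq> z"
    using join not_le_kappa[OF sd J] by (metis inf_le2 order_trans sup_ge2)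
  ultimately have "inf z (kappa j) = y"
    using yz by (intro between) auto
  with J join show ?thesis
    by (rule that)
qed

lemma Sup_JIc_below:
  fixes x :: "'a::complete_lattice"
  assumes wa: "weakly_atomic TYPE('a)" and sd: "completely_semidistributive TYPE('a)"
  shows "Sup {j \<in> JIc. j \<le> x} = x"
proof (rule ccontr)
  assume ne: "Sup {j \<in> JIc. j \<le> x} \<noteq> x"
  have "Sup {j \<in> JIc. j \<le> x} \<le> x"
    by (rule Sup_least) auto
  with ne have "Sup {j \<in> JIc. j \<le> x} < x"
    by simp
  then obtain u v where uv: "Sup {j \<in> JIc. j \<le> x} \<le> u" "u \<lessdot> v" "v \<le> x"
    using wa unfolding weakly_atomic_def by blast
  \<comment> \<open>The label of a cover below \<open>x\<close> lies below \<open>x\<close>, but not below the bottom of the cover.\<close>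
  obtain j where j: "j \<in> JIc" "sup u j = v"
    using cover_label[OF sd uv(2)] by blast
  have "j \<le> x"
    using j(2) uv(3) by (metis order_trans sup_ge2)
  with j(1) have "j \<le> u"
    using uv(1) by (metis (mono_tags, lifting) Sup_upper mem_Collect_eq order_trans)
  then show False
    using j(2) uv(2) by (simp add: covers_def sup.absorb1)
qed

section \<open>Characterisations of left modular elements\<close>

lemma sup_eq_sup_iff: "y \<le> z \<Longrightarrow> sup x y = sup x z \<longleftrightarrow> z \<le> sup x (y::'a::lattice)"
  using sup.mono[OF order_refl, of y z x] by (auto simp: order.eq_iff)

lemma inf_eq_inf_iff: "y \<le> z \<Longrightarrow> inf x y = inf x z \<longleftrightarrow> inf x z \<le> (y::'a::lattice)"
  using inf_mono[OF order_refl, of y z x] by (auto simp: order.eq_iff)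

lemma left_modular_iff_covers:
  fixes x :: "'a::complete_lattice"
  assumes wa: "weakly_atomic TYPE('a)"
  shows "left_modular x \<longleftrightarrow>
    (\<forall>y z. y \<lessdot> z \<longrightarrow>
      (sup x y = sup x z \<or> inf x y = inf x z) \<and> \<not> (sup x y = sup x z \<and> inf x y = inf x z))"
    (is "_ \<longleftrightarrow> ?C")
proof
  assume lm: "left_modular x"
  show ?C
  proof (intro allI impI)
    fix y z :: 'a
    assume cov: "y \<lessdot> z"
    then have yz: "y < z" and between: "\<And>w. y \<le> w \<Longrightarrow> w \<le> z \<Longrightarrow> w = y \<or> w = z"
      unfolding covers_def by (auto simp: order.order_iff_strict)
    have eq: "inf (sup y x) z = sup y (inf x z)"
      using lm yz unfolding left_modular_def by simp
    \<comment> \<open>Both sides of the modular law lie between \<open>y\<close> and \<open>z\<close>. The left one is \<open>z\<close> precisely if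
      joining with \<open>x\<close> identifies \<open>y\<close> and \<open>z\<close>, the right one is \<open>y\<close> precisely if meeting does.\<close>
    have "inf (sup y x) z = z \<longleftrightarrow> sup x y = sup x z"
      unfolding sup_eq_sup_iff[OF less_imp_le[OF yz]] by (simp add: inf.absorb_iff2 sup_commute)
    moreover have "sup y (inf x z) = y \<longleftrightarrow> inf x y = inf x z"
      unfolding inf_eq_inf_iff[OF less_imp_le[OF yz]] by (simp add: sup.absorb_iff1)
    moreover have "sup y (inf x z) = y \<or> sup y (inf x z) = z"
      using yz by (intro between) auto
    ultimately show "(sup x y = sup x z \<or> inf x y = inf x z) \<and>
        \<not> (sup x y = sup x z \<and> inf x y = inf x z)"
      using eq yz by auto
  qed
next
  assume C: ?C
  show "left_modular x"
    unfolding left_modular_def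
  proof (intro allI impI, rule ccontr)
    fix y z :: 'a
    assume "y \<le> z" and ne: "inf (sup y x) z \<noteq> sup y (inf x z)"
    have "sup y (inf x z) \<le> inf (sup y x) z"
      using \<open>y \<le> z\<close> by (auto intro: le_supI2 le_infI1)
    with ne have "sup y (inf x z) < inf (sup y x) z"
      by (intro le_neq_trans) auto
    then obtain u v where lo: "sup y (inf x z) \<le> u" and cov: "u \<lessdot> v" and hi: "v \<le> inf (sup y x) z"
      using wa unfolding weakly_atomic_def by blast
    have uv: "u \<le> v"
      using cov unfolding covers_def by (blast intro: less_imp_le)
    have "y \<le> u" and "inf x z \<le> u" and "v \<le> sup y x" and "v \<le> z"
      using lo hi by simp_all
    have "v \<le> sup x u"
      using \<open>v \<le> sup y x\<close> by (rule order_trans) (use \<open>y \<le> u\<close> in \<open>auto intro: le_supI2\<close>)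
    moreover have "inf x v \<le> u"
      by (rule order_trans[OF _ \<open>inf x z \<le> u\<close>]) (use \<open>v \<le> z\<close> in \<open>auto intro: le_infI2\<close>)
    ultimately show False
      using C cov sup_eq_sup_iff[OF uv, of x] inf_eq_inf_iff[OF uv, of x] by blast
  qed
qed

lemma covers_iff_dichotomy:
  fixes x :: "'a::complete_lattice"
  assumes sd: "completely_semidistributive TYPE('a)"
  shows "(\<forall>y z. y \<lessdot> z \<longrightarrow>
      (sup x y = sup x z \<or> inf x y = inf x z) \<and> \<not> (sup x y = sup x z \<and> inf x y = inf x z)) \<longleftrightarrow>
    (\<forall>j\<in>JIc. j \<le> x \<or> x \<le> kappa j)" (is "?C \<longleftrightarrow> ?D")
proof
  assume C: ?C
  show ?D
  proof
    fix j :: 'a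
    assume j: "j \<in> JIc"
    let ?s = "lower_star j"
    have cov: "?s \<lessdot> j"
      using j by (rule lower_star_covered)
    have iff: "sup x ?s = sup x j \<longleftrightarrow> j \<le> sup x ?s" "inf x ?s = inf x j \<longleftrightarrow> inf x j \<le> ?s"
      by (rule sup_eq_sup_iff[OF lower_star_le], rule inf_eq_inf_iff[OF lower_star_le])
    show "j \<le> x \<or> x \<le> kappa j"
    proof (cases "inf x j \<le> ?s")
      case True
      then have "\<not> j \<le> sup x ?s"
        using C cov iff by blast
      then have "sup x ?s \<le> kappa j"
        using le_or_le_kappa_above_lower_star[OF sd j sup_ge2] by blast
      then show ?thesis
        by simp
    next
      case False
      then have "\<not> inf x j < j"
        using le_lower_star by blast
      then have "inf x j = j"
        by (simp add: order.strict_iff_order)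
      then show ?thesis
        by (metis inf_le1)
    qed
  qed
next
  assume D: ?D
  show ?C
  proof (intro allI impI)
    fix y z :: 'a
    assume cov: "y \<lessdot> z"
    obtain j where j: "j \<in> JIc" "sup y j = z" "inf z (kappa j) = y"
      using cover_label[OF sd cov] by blast
    have not_le: "\<not> j \<le> kappa j"
      using sd j(1) by (rule not_le_kappa)
    have jz: "j \<le> z" and yk: "y \<le> kappa j" and yz: "y \<le> z"
      using sup_ge2[of j y] inf_le2[of z "kappa j"] sup_ge1[of y j] unfolding j(2,3) by simp_all
    have iff: "sup x y = sup x z \<longleftrightarrow> z \<le> sup x y" "inf x y = inf x z \<longleftrightarrow> inf x z \<le> y"
      by (rule sup_eq_sup_iff[OF yz], rule inf_eq_inf_iff[OF yz])
    have "j \<le> x \<or> x \<le> kappa j"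
      using D j(1) by blast
    then show "(sup x y = sup x z \<or> inf x y = inf x z) \<and>
        \<not> (sup x y = sup x z \<and> inf x y = inf x z)"
    proof
      assume "j \<le> x"
      then have "z \<le> sup x y"
        using j(2) by (auto intro: le_supI1)
      moreover have "\<not> inf x z \<le> y"
        using \<open>j \<le> x\<close> jz yk not_le by (meson le_infI order_trans)
      ultimately show ?thesis
        using iff by blast
    next
      assume "x \<le> kappa j"
      then have "inf x z \<le> y"
        using j(3) by (auto intro: le_infI1)
      moreover have "\<not> z \<le> sup x y"
        using \<open>x \<le> kappa j\<close> jz yk not_le by (meson le_supI order_trans)
      ultimately show ?thesis
        using iff by blast
    qed
  qed
qed

text \<open>
  An arrow \<open>i \<rightarrow> j\<close> means that \<open>i\<close> obstructs the alternative \<open>x \<le> kappa j\<close> for all \<open>x\<close> above \<open>i\<close>,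
  so the dichotomy forces \<open>j \<le> x\<close>; this is closure under successors of the set of all \<open>j \<le> x\<close>.
  In the other direction, a join of \<open>S\<close> not below \<open>kappa j\<close> has some \<open>i \<in> S\<close> not below \<open>kappa j\<close>,
  and then \<open>j\<close> is \<open>i\<close> or one of its successors.
\<close>

lemma dichotomy_iff_successor_closed:
  fixes x :: "'a::complete_lattice"
  assumes wa: "weakly_atomic TYPE('a)" and sd: "completely_semidistributive TYPE('a)"
  shows "(\<forall>j\<in>JIc. j \<le> x \<or> x \<le> kappa j) \<longleftrightarrow>
    (\<exists>S. successor_closed labelling_quiver S \<and> x = Sup S)" (is "?D \<longleftrightarrow> ?S")
proof
  assume D: ?D
  have "j \<le> x" if "i \<le> x" "j \<in> JIc" "\<not> i \<le> kappa j" for i j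
    using D that by (meson order_trans)
  then have "successor_closed labelling_quiver {j \<in> JIc. j \<le> x}"
    unfolding successor_closed_def labelling_quiver_def by auto
  then show ?S
    using Sup_JIc_below[OF wa sd, of x, symmetric] by blast
next
  assume ?S
  then obtain S where S: "successor_closed labelling_quiver S" and x: "x = Sup S"
    by blast
  show ?D
  proof
    fix j :: 'a
    assume j: "j \<in> JIc"
    show "j \<le> x \<or> x \<le> kappa j"
    proof (cases "\<forall>i\<in>S. i \<le> kappa j")
      case True
      then show ?thesis
        using x by (simp add: Sup_least)
    next
      case False
      then obtain i where i: "i \<in> S" "\<not> i \<le> kappa j"
        by blast
      then have "j \<in> S"
        using S j unfolding successor_closed_def labelling_quiver_def by (cases "i = j") auto
      then show ?thesis
        using x by (simp add: Sup_upper)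
    qed
  qed
qed

lemma left_modular_iff_dichotomy:
  fixes x :: "'a::complete_lattice"
  assumes "weakly_atomic TYPE('a)" and "completely_semidistributive TYPE('a)"
  shows "left_modular x \<longleftrightarrow> (\<forall>j\<in>JIc. j \<le> x \<or> x \<le> kappa j)"
  using left_modular_iff_covers[OF assms(1)] covers_iff_dichotomy[OF assms(2)] by (rule trans)

section \<open>The lattice of left modular elements\<close>

lemma dichotomy_Sup:
  assumes "\<And>a. a \<in> A \<Longrightarrow> j \<le> a \<or> a \<le> kappa (j::'a::complete_lattice)"
  shows "j \<le> Sup A \<or> Sup A \<le> kappa j"
proof (cases "\<exists>a\<in>A. j \<le> a")
  case True
  then show ?thesis
    by (blast intro: Sup_upper2)
next
  case False
  then show ?thesis
    using assms by (blast intro: Sup_least)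
qed

lemma dichotomy_Inf:
  assumes "\<And>a. a \<in> A \<Longrightarrow> j \<le> a \<or> a \<le> kappa (j::'a::complete_lattice)"
  shows "j \<le> Inf A \<or> Inf A \<le> kappa j"
proof (cases "\<exists>a\<in>A. a \<le> kappa j")
  case True
  then show ?thesis
    by (blast intro: Inf_lower2)
next
  case False
  then show ?thesis
    using assms by (blast intro: Inf_greatest)
qed

lemma dichotomy_join_prime:
  assumes "completely_semidistributive TYPE('a::complete_lattice)"
    and "j \<in> (JIc :: 'a set)"
    and "\<And>a. a \<in> A \<Longrightarrow> j \<le> a \<or> a \<le> kappa j"
    and "j \<le> Sup A"
  shows "\<exists>a\<in>A. j \<le> a"
proof (rule ccontr)
  assume "\<not> (\<exists>a\<in>A. j \<le> a)"
  then have "Sup A \<le> kappa j"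
    using assms(3) by (blast intro: Sup_least)
  then show False
    using not_le_kappa[OF assms(1,2)] assms(4) order_trans by blast
qed

lemma complete_sublattice_LM:
  assumes "weakly_atomic TYPE('a::complete_lattice)" and "completely_semidistributive TYPE('a)"
  shows "complete_sublattice (LM :: 'a set)"
proof -
  have LM: "(LM :: 'a set) = {x. \<forall>j\<in>JIc. j \<le> x \<or> x \<le> kappa j}"
    unfolding LM_def left_modular_iff_dichotomy[OF assms] ..
  show ?thesis
    unfolding complete_sublattice_def LM
    by (intro allI impI conjI CollectI ballI dichotomy_Sup dichotomy_Inf; blast)
qed

text \<open>
  Only the inequality from left to right has content. It suffices to test it on the \<open>j \<in> JIc\<close> below
  the left side; such a \<open>j\<close> is below every \<open>Sup A\<close>, hence by primeness below some member of each
  \<open>A\<close>, and these members form the choice function required on the right.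
\<close>

lemma completely_distributive_on_LM:
  assumes wa: "weakly_atomic TYPE('a::complete_lattice)"
    and sd: "completely_semidistributive TYPE('a)"
  shows "completely_distributive_on (LM :: 'a set)"
  unfolding completely_distributive_on_def
proof (intro allI impI)
  fix \<A> :: "'a set set"
  assume sub: "\<forall>A\<in>\<A>. A \<subseteq> LM"
  let ?l = "Inf (Sup ` \<A>)"
  let ?r = "Sup (Inf ` {f ` \<A> | f. \<forall>A\<in>\<A>. f A \<in> A})"
  have "j \<le> ?r" if j: "j \<in> JIc" "j \<le> ?l" for j
  proof -
    have "\<exists>a\<in>A. j \<le> a" if A: "A \<in> \<A>" for A
    proof (rule dichotomy_join_prime[OF sd j(1)])
      show "j \<le> a \<or> a \<le> kappa j" if "a \<in> A" for a
        using sub A that j(1) left_modular_iff_dichotomy[OF wa sd] unfolding LM_def by blast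
      show "j \<le> Sup A"
        using j(2) A by (meson INF_lower order_trans)
    qed
    then obtain f where f: "\<forall>A\<in>\<A>. f A \<in> A \<and> j \<le> f A"
      by metis
    then have "j \<le> Inf (f ` \<A>)"
      by (auto intro: INF_greatest)
    also have "\<dots> \<le> ?r"
      using f by (intro Sup_upper) blast
    finally show ?thesis .
  qed
  then have "Sup {j \<in> JIc. j \<le> ?l} \<le> ?r"
    by (intro Sup_least) blast
  then have "?l \<le> ?r"
    by (simp only: Sup_JIc_below[OF wa sd])
  moreover have "?r \<le> ?l"
    by (rule Sup_Inf_le)
  ultimately show "?l = ?r"
    by (rule antisym)
qed

theorem theorem1p3:
  assumes "weakly_atomic TYPE('a::complete_lattice)"
    and "completely_semidistributive TYPE('a)"
  shows "(\<forall>x::'a.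
            (left_modular x \<longleftrightarrow> (\<forall>j\<in>JIc. j \<le> x \<or> x \<le> kappa j)) \<and>
            (left_modular x \<longleftrightarrow>
               (\<forall>y z. y \<lessdot> z \<longrightarrow>
                  (sup x y = sup x z \<or> inf x y = inf x z) \<and>
                  \<not> (sup x y = sup x z \<and> inf x y = inf x z))) \<and>
            (left_modular x \<longleftrightarrow> (\<exists>S. successor_closed labelling_quiver S \<and> x = Sup S))) \<and>
         complete_sublattice (LM :: 'a set) \<and>
         completely_distributive_on (LM :: 'a set)"
  by (intro conjI allI left_modular_iff_dichotomy left_modular_iff_covers
        complete_sublattice_LM completely_distributive_on_LM assms
        trans[OF left_modular_iff_dichotomy[OF assms] dichotomy_iff_successor_closed[OF assms]])

end
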